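(* Let $S_1,\dots,S_q$ be a basis of a linear subspace $\mathcal S\subseteq\mathbb{R}^{m\times n}$, let $A=\sum_{i=1}^qa_iS_i\in\mathcal S$ with $a=[a_1,\dots,a_q]^\top$, and let $b\in\mathbb{R}^m$ be such that the genericity condition $\widetilde\sigma_n>\sigma_{n+1}$ holds. Let $x$ be the unique TLS solution and $r=b-Ax$, with $x\neq0$ and $r\ne0$. When $L=I_n$, $$\kappa_{s,\infty}^{\mathrm{rel}}=m_s(A,b).$$
   Context: Let $m>n$. The total least squares (TLS) problem for $A\in\mathbb{R}^{m\times n}$, $b\in\mathbb{R}^m$ is to minimize $\|[A,b]-[\widehat A,\widehat b]\|_F$ over $[\widehat A,\widehat b]\in\mathbb{R}^{m\times(n+1)}$ with $\widehat b$ in the range of $\widehat A$; any $x$ with $\widehat A x=\widehat b$ for a minimizer is a TLS solution. Let $\widetilde\sigma_n$ be the smallest singular value of $A$ and $\sigma_{n+1}$ the smallest singular value of $[A,b]$. Under the genericity condition $\widetilde\sigma_n>\sigma_{n+1}$ there is a unique TLS solution $x$; $\begin{bmatrix}x\\-1\end{bmatrix}$ is a multiple of the right singular vector of $[A,b]$ for $\sigma_{n+1}$, and $(A^\top A-\sigma_{n+1}^2I_n)x=A^\top b$. Put $P=A^\top A-\sigma_{n+1}^2I_n$. For $L\in\mathbb{R}^{k\times n}$, the relative structured mixed condition number of $\Psi_s(a,b)=Lx$ has the expression $$\kappa_{s,\infty}^{\mathrm{rel}}=\frac{\left\|\,|L\mathcal N_s||a|+|L\mathcal H||b|\,\right\|_\infty}{\|Lx\|_\infty},$$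 where $\mathcal N_s=P^{-1}V$, $V=[v_1,\dots,v_q]\in\mathbb{R}^{n\times q}$, $v_i=S_i^\top r-\left[A^\top+\frac{2xr^\top}{1+x^\top x}\right]S_ix$, and $\mathcal H=P^{-1}\left[A^\top+\frac{2xr^\top}{1+x^\top x}\right]$. The structured mixed condition number $m_s(A,b)$ of Li and Jia is given by the expression $$m_s(A,b)=\frac{\left\|\,\left|K\mathcal M^{st}_{A,b}\right|\begin{bmatrix}|a|\\|b|\end{bmatrix}\right\|_\infty}{\|x\|_\infty},$$ where $$\mathcal M^{st}=[\mathrm{vec}(S_1),\dots,\mathrm{vec}(S_q)],\qquad \mathcal M^{st}_{A,b}=\begin{bmatrix}\mathcal M^{st}&0\\0&I_m\end{bmatrix},\qquad G(x)=\begin{bmatrix}x^\top&-1\end{bmatrix}\otimes I_m,$$ $$K=P^{-1}\left(2A^\top\frac{rr^\top}{\|r\|_2^2}G(x)-A^\top G(x)+\begin{bmatrix}I_n\otimes r^\top&0\end{bmatrix}\right).$$ $|\cdot|$ is the entrywise absolute value, $\otimes$ the Kronecker product $[a_{ij}B]$, and $\mathrm{vec}$ stacks columns. *)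

theory Defs
  imports "HOL-Analysis.Analysis"
begin

text \<open>
  Matrices with \<open>m\<close> rows and \<open>n\<close> columns have type \<open>real^'n^'m\<close>. The library norm on this type is
  the Frobenius norm, and the library absolute value on vectors and matrices is entrywise.
  Concatenated blocks are indexed by a sum type, Kronecker products and \<open>vec\<close> by a product type:
  the index \<open>(j, i)\<close> stands for entry \<open>i\<close> of block \<open>j\<close>, so that lexicographic order of pairs is the
  usual order of entries.
\<close>

definition outer :: "real^'n \<Rightarrow> real^'m \<Rightarrow> real^'m^'n" where
  "outer x y = (columnvector x :: real^1^'n) ** (rowvector y :: real^'m^1)"

definition hcat :: "real^'n^'m \<Rightarrow> real^'k^'m \<Rightarrow> real^('n + 'k)^'m" where
  "hcat A B = (\<chi> i j. case j of Inl p \<Rightarrow> A $ i $ p | Inr p \<Rightarrow> B $ i $ p)"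

text \<open>For vectors this is concatenation; as a matrix is a vector of rows, for matrices it puts the
  first argument on top of the second.\<close>

definition vcat :: "'a^'m \<Rightarrow> 'a^'k \<Rightarrow> 'a^('m + 'k)" where
  "vcat u v = (\<chi> i. case i of Inl p \<Rightarrow> u $ p | Inr p \<Rightarrow> v $ p)"

definition kron :: "real^'n^'m \<Rightarrow> real^'l^'k \<Rightarrow> real^('n \<times> 'l)^('m \<times> 'k)" where
  "kron A B = (\<chi> i j. A $ fst i $ fst j * B $ snd i $ snd j)"

definition vec_of_mat :: "real^'n^'m \<Rightarrow> real^('n \<times> 'm)" where
  "vec_of_mat A = (\<chi> j. A $ snd j $ fst j)"

text \<open>Only used below with bijections, to identify index types of equal size (such as
  \<open>1 \<times> 'm\<close> and \<open>'m\<close>).\<close>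

definition reindex :: "('a \<Rightarrow> 'c) \<Rightarrow> ('b \<Rightarrow> 'd) \<Rightarrow> real^'d^'c \<Rightarrow> real^'b^'a" where
  "reindex f g M = (\<chi> i j. M $ f i $ g j)"

text \<open>Singular values as the square roots of the eigenvalues of \<open>M\<^sup>T M\<close>. This is the standard notion
  when \<open>M\<close> has at least as many rows as columns, which holds in all uses here.\<close>

definition singular_value :: "real^'n^'m \<Rightarrow> real \<Rightarrow> bool" where
  "singular_value M s \<longleftrightarrow>
     0 \<le> s \<and> (\<exists>v. v \<noteq> 0 \<and> (transpose M ** M) *v v = s\<^sup>2 *\<^sub>R v)"

definition smallest_singular_value :: "real^'n^'m \<Rightarrow> real" where
  "smallest_singular_value M = (LEAST s. singular_value M s)"

definition augmented :: "real^'n^'m \<Rightarrow> real^'m \<Rightarrow> real^('n + 1)^'m" where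
  "augmented A b = hcat A (columnvector b)"

definition tls_solution :: "real^'n^'m \<Rightarrow> real^'m \<Rightarrow> real^'n \<Rightarrow> bool" where
  "tls_solution A b x \<longleftrightarrow>
     (\<exists>A' b'.
        is_arg_min (\<lambda>(C, d). norm (augmented A b - augmented C d))
                   (\<lambda>(C, d). d \<in> range (\<lambda>y. C *v y)) (A', b') \<and>
        A' *v x = b')"

definition residual :: "real^'n^'m \<Rightarrow> real^'m \<Rightarrow> real^'n \<Rightarrow> real^'m" where
  "residual A b x = b - A *v x"

definition P_mat :: "real^'n^'m \<Rightarrow> real^'m \<Rightarrow> real^'n^'n" where
  "P_mat A b =
     transpose A ** A - (smallest_singular_value (augmented A b))\<^sup>2 *\<^sub>R mat 1"

text \<open>The matrix \<open>A\<^sup>T + 2 x r\<^sup>T / (1 + x\<^sup>T x)\<close>, common to \<open>v\<^sub>i\<close> and \<open>\<H>\<close>.\<close>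

definition Q_mat :: "real^'n^'m \<Rightarrow> real^'m \<Rightarrow> real^'n \<Rightarrow> real^'m^'n" where
  "Q_mat A b x =
     transpose A + (2 / (1 + x \<bullet> x)) *\<^sub>R outer x (residual A b x)"

definition V_mat ::
  "('q::finite \<Rightarrow> real^'n^'m) \<Rightarrow> real^'n^'m \<Rightarrow> real^'m \<Rightarrow> real^'n \<Rightarrow> real^'q^'n" where
  "V_mat S A b x =
     (\<chi> j i. (transpose (S i) *v residual A b x - Q_mat A b x *v (S i *v x)) $ j)"

definition N_mat ::
  "('q::finite \<Rightarrow> real^'n^'m) \<Rightarrow> real^'n^'m \<Rightarrow> real^'m \<Rightarrow> real^'n \<Rightarrow> real^'q^'n" where
  "N_mat S A b x = matrix_inv (P_mat A b) ** V_mat S A b x"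

definition H_mat :: "real^'n^'m \<Rightarrow> real^'m \<Rightarrow> real^'n \<Rightarrow> real^'m^'n" where
  "H_mat A b x = matrix_inv (P_mat A b) ** Q_mat A b x"

text \<open>The relative structured mixed condition number of \<open>(a, b) \<mapsto> L x\<close> (given by its expression),
  where \<open>A\<close> is the matrix with coefficient vector \<open>a\<close> with respect to \<open>S\<close>.\<close>

definition kappa_s_inf_rel ::
  "real^'n^'k \<Rightarrow> ('q::finite \<Rightarrow> real^'n^'m) \<Rightarrow> real^'q \<Rightarrow> real^'n^'m \<Rightarrow> real^'m \<Rightarrow> real^'n \<Rightarrow> real" where
  "kappa_s_inf_rel L S a A b x =
     infnorm (\<bar>L ** N_mat S A b x\<bar> *v \<bar>a\<bar> + \<bar>L ** H_mat A b x\<bar> *v \<bar>b\<bar>) / infnorm (L *v x)"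

definition Mst :: "('q::finite \<Rightarrow> real^'n^'m) \<Rightarrow> real^'q^('n \<times> 'm)" where
  "Mst S = (\<chi> j i. vec_of_mat (S i) $ j)"

definition Mst_Ab :: "('q::finite \<Rightarrow> real^'n^'m) \<Rightarrow> real^('q + 'm)^(('n \<times> 'm) + 'm)" where
  "Mst_Ab S = vcat (hcat (Mst S) 0) (hcat 0 (mat 1))"

text \<open>\<open>[x\<^sup>T, -1] \<otimes> I\<^sub>m\<close>, with the row index type \<open>1 \<times> 'm\<close> identified with \<open>'m\<close>, and the column index
  type \<open>('n + 1) \<times> 'm\<close> identified with \<open>('n \<times> 'm) + 'm\<close>.\<close>

definition G_mat :: "real^'n \<Rightarrow> real^(('n \<times> 'm) + 'm)^'m" where
  "G_mat x =
     reindex (\<lambda>i. (1, i)) (\<lambda>j. case j of Inl (p, i) \<Rightarrow> (Inl p, i) | Inr i \<Rightarrow> (Inr 1, i))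
       (kron (hcat (rowvector x :: real^'n^1) (mat (- 1) :: real^1^1)) (mat 1 :: real^'m^'m))"

text \<open>\<open>I\<^sub>n \<otimes> r\<^sup>T\<close>, with the row index type \<open>'n \<times> 1\<close> identified with \<open>'n\<close>.\<close>

definition I_kron_row :: "real^'m \<Rightarrow> real^('n \<times> 'm)^'n" where
  "I_kron_row r =
     reindex (\<lambda>i. (i, 1)) id (kron (mat 1 :: real^'n^'n) (rowvector r :: real^'m^1))"

definition K_mat ::
  "real^'n^'m \<Rightarrow> real^'m \<Rightarrow> real^'n \<Rightarrow> real^(('n \<times> 'm) + 'm)^'n" where
  "K_mat A b x =
     (let r = residual A b x in
      matrix_inv (P_mat A b) **
        (2 *\<^sub>R (transpose A ** ((1 / (norm r)\<^sup>2) *\<^sub>R outer r r) ** G_mat x)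
         - transpose A ** G_mat x
         + hcat (I_kron_row r) 0))"

text \<open>The structured mixed condition number of Li and Jia (given by its expression).\<close>

definition m_s ::
  "('q::finite \<Rightarrow> real^'n^'m) \<Rightarrow> real^'q \<Rightarrow> real^'n^'m \<Rightarrow> real^'m \<Rightarrow> real^'n \<Rightarrow> real" where
  "m_s S a A b x =
     infnorm (\<bar>K_mat A b x ** Mst_Ab S\<bar> *v vcat \<bar>a\<bar> \<bar>b\<bar>) / infnorm x"

end

theory Submission
  imports Defs
begin

text \<open>
  Both condition numbers are the largest component of a matrix with nonnegative entries applied to
  the stacked vector of \<open>\<bar>a\<bar>\<close> and \<open>\<bar>b\<bar>\<close>, divided by the same number. The two matrices agree
  because they are entrywise absolute values of the same matrix: \<open>K M\<^sup>s\<^sup>t\<^sub>A\<^sub>b = [N\<^sub>s, H]\<close>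
  (lemma \<open>K_mat_mult_Mst_Ab\<close>).

  For the blocks, \<open>G(x)\<close> sends \<open>vec E\<close> in the first block to \<open>E x\<close> and is \<open>-I\<close> on the second, while
  \<open>I \<otimes> r\<^sup>T\<close> sends \<open>vec E\<close> to \<open>E\<^sup>T r\<close>. So everything reduces to comparing the two matrices that
  multiply \<open>G(x)\<close>, that is, to
  \<open>A\<^sup>T r r\<^sup>T / \<parallel>r\<parallel>\<^sup>2 = - x r\<^sup>T / (1 + x\<^sup>T x)\<close>, which follows from
  \<open>(1 + x\<^sup>T x) A\<^sup>T r = - \<parallel>r\<parallel>\<^sup>2 x\<close>.

  This last equation is the vanishing of the gradient of the Rayleigh-type quotient
  \<open>\<parallel>b - A y\<parallel>\<^sup>2 / (1 + y\<^sup>T y)\<close> at \<open>y = x\<close> (lemma \<open>tls_stationarity\<close>). The quotient is minimal at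
  \<open>x\<close> because its value at \<open>y\<close> is the smallest squared Frobenius norm of a perturbation of
  \<open>[A, b]\<close> that makes \<open>y\<close> solve the perturbed system, and a total least squares solution makes this
  cost as small as possible.
\<close>

section \<open>Block matrices\<close>

lemma sum_UNIV_sum_type:
  fixes f :: "'a::finite + 'b::finite \<Rightarrow> 'c::comm_monoid_add"
  shows "sum f UNIV = (\<Sum>p\<in>UNIV. f (Inl p)) + (\<Sum>p\<in>UNIV. f (Inr p))"
  unfolding UNIV_Plus_UNIV[symmetric] by (subst sum.Plus) auto

lemma hcat_mult_vcat:
  fixes A :: "real^'n^'m" and B :: "real^'k^'m" and C :: "real^'l^'n" and D :: "real^'l^'k"
  shows "hcat A B ** vcat C D = A ** C + B ** D"
  by (simp add: matrix_matrix_mult_def hcat_def vcat_def vec_eq_iff sum_UNIV_sum_type)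

lemma hcat_vector_mult_vcat:
  fixes A :: "real^'n^'m" and B :: "real^'k^'m" and u :: "real^'n" and v :: "real^'k"
  shows "hcat A B *v vcat u v = A *v u + B *v v"
  by (simp add: matrix_vector_mult_def hcat_def vcat_def vec_eq_iff sum_UNIV_sum_type)

lemma mult_hcat:
  fixes M :: "real^'m^'l" and A :: "real^'n^'m" and B :: "real^'k^'m"
  shows "M ** hcat A B = hcat (M ** A) (M ** B)"
  by (auto simp add: matrix_matrix_mult_def hcat_def vec_eq_iff split: sum.split)

lemma hcat_add:
  fixes A C :: "real^'n^'m" and B D :: "real^'k^'m"
  shows "hcat A B + hcat C D = hcat (A + C) (B + D)"
  by (auto simp: hcat_def vec_eq_iff split: sum.split)

lemma hcat_diff:
  fixes A C :: "real^'n^'m" and B D :: "real^'k^'m"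
  shows "hcat A B - hcat C D = hcat (A - C) (B - D)"
  by (auto simp: hcat_def vec_eq_iff split: sum.split)

lemma abs_hcat: "\<bar>hcat A B\<bar> = hcat \<bar>A\<bar> \<bar>B\<bar>"
  by (auto simp: hcat_def vec_eq_iff abs_vec_def split: sum.split)

lemma outer_nth: "outer u v $ i = u $ i *\<^sub>R v"
  by (simp add: outer_def matrix_matrix_mult_def columnvector_def rowvector_def vec_eq_iff)

lemma outer_mult_vec: "outer u v *v y = (v \<bullet> y) *\<^sub>R u"
  by (simp add: matrix_vector_mult_def outer_nth vec_eq_iff inner_vec_def sum_distrib_left
      sum_distrib_right mult_ac)

lemma mult_outer: "M ** outer u v = outer (M *v u) v"
  by (simp add: matrix_matrix_mult_def matrix_vector_mult_def outer_nth vec_eq_iff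
      sum_distrib_left sum_distrib_right mult_ac)

lemma outer_scaleR_left: "outer (c *\<^sub>R u) v = c *\<^sub>R outer u v"
  by (simp add: vec_eq_iff outer_nth)

lemma outer_minus_left: "outer (- u) v = - outer u v"
  by (simp add: vec_eq_iff outer_nth)

lemma matrix_add_mult_rdistrib:
  fixes A B :: "real^'n^'m" and C :: "real^'k^'n"
  shows "(A + B) ** C = A ** C + B ** C"
  by (simp add: matrix_matrix_mult_def vec_eq_iff distrib_right sum.distrib)

lemma matrix_diff_rdistrib:
  fixes A B :: "real^'n^'m" and C :: "real^'k^'n"
  shows "(A - B) ** C = A ** C - B ** C"
  by (simp add: matrix_matrix_mult_def vec_eq_iff left_diff_distrib sum_subtractf)

lemma matrix_mult_minus:
  fixes A :: "real^'n^'m" and B :: "real^'k^'n"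
  shows "A ** (- B) = - (A ** B)"
  by (simp add: matrix_matrix_mult_def vec_eq_iff sum_negf)

lemma matrix_minus_mult:
  fixes A :: "real^'n^'m" and B :: "real^'k^'n"
  shows "(- A) ** B = - (A ** B)"
  by (simp add: matrix_matrix_mult_def vec_eq_iff sum_negf)

section \<open>Stationarity of a total least squares solution\<close>

text \<open>
  Pairing row \<open>i\<close> of \<open>E\<close> with entry \<open>i\<close> of \<open>e\<close> in the product space makes the row of the augmented
  matrix available to the Cauchy-Schwarz inequality without coordinates.
\<close>

lemma norm_augmented_sq:
  fixes E :: "real^'n^'m" and e :: "real^'m"
  shows "(norm (augmented E e))\<^sup>2 = (\<Sum>i\<in>UNIV. (norm (E $ i, e $ i))\<^sup>2)"
proof -
  have "(norm (augmented E e $ i))\<^sup>2 = (norm (E $ i, e $ i))\<^sup>2" for i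
    unfolding power2_norm_eq_inner
    by (simp add: augmented_def hcat_def columnvector_def inner_vec_def sum_UNIV_sum_type)
  moreover have "(norm (augmented E e))\<^sup>2 = (\<Sum>i\<in>UNIV. (norm (augmented E e $ i))\<^sup>2)"
    by (simp add: power2_norm_eq_inner inner_vec_def)
  ultimately show ?thesis by simp
qed

lemma augmented_diff: "augmented A b - augmented C d = augmented (A - C) (b - d)"
  by (auto simp: augmented_def hcat_def columnvector_def vec_eq_iff split: sum.split)

text \<open>
  With \<open>E = A - C\<close> and \<open>e = b - d\<close>, the residual is \<open>e - E x = -[E, e] (x, -1)\<close>. Cauchy-Schwarz
  in each row bounds its squared norm by \<open>\<parallel>(x, -1)\<parallel>\<^sup>2 = 1 + x\<^sup>T x\<close> times the squared Frobenius
  norm of \<open>[E, e]\<close>.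
\<close>

lemma perturbation_norm_lower_bound:
  fixes A C :: "real^'n^'m"
  assumes "C *v x = d"
  shows "(norm (residual A b x))\<^sup>2 \<le> (1 + x \<bullet> x) * (norm (augmented A b - augmented C d))\<^sup>2"
proof -
  have "(residual A b x $ i)\<^sup>2 \<le> (1 + x \<bullet> x) * (norm ((A - C) $ i, (b - d) $ i))\<^sup>2" for i
  proof -
    have "residual A b x = (b - d) - (A - C) *v x"
      using assms by (simp add: residual_def matrix_vector_mult_diff_rdistrib)
    then have "residual A b x $ i = - (((A - C) $ i, (b - d) $ i) \<bullet> (x, - 1))"
      by (simp add: matrix_vector_mul_component)
    then have "(residual A b x $ i)\<^sup>2 = (((A - C) $ i, (b - d) $ i) \<bullet> (x, - 1))\<^sup>2"
      by (simp only: power2_minus)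
    also have "\<dots> \<le> (((A - C) $ i, (b - d) $ i) \<bullet> ((A - C) $ i, (b - d) $ i))
        * ((x, - 1 :: real) \<bullet> (x, - 1))"
      by (rule Cauchy_Schwarz_ineq)
    finally show ?thesis
      by (simp add: power2_norm_eq_inner mult.commute add.commute)
  qed
  then have "(\<Sum>i\<in>UNIV. (residual A b x $ i)\<^sup>2)
      \<le> (\<Sum>i\<in>UNIV. (1 + x \<bullet> x) * (norm ((A - C) $ i, (b - d) $ i))\<^sup>2)"
    by (intro sum_mono)
  moreover have "(norm (residual A b x))\<^sup>2 = (\<Sum>i\<in>UNIV. (residual A b x $ i)\<^sup>2)"
    unfolding power2_norm_eq_inner by (simp add: inner_vec_def power2_eq_square)
  ultimately show ?thesis
    by (simp only: augmented_diff norm_augmented_sq sum_distrib_left)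
qed

text \<open>
  Equality in the previous bound requires every row of the perturbation to be parallel to
  \<open>(y, -1)\<close>. The witness is therefore the orthogonal projection of \<open>[A, b]\<close> onto the matrices that
  annihilate \<open>(y, -1)\<close>, a change of rank at most one.
\<close>

lemma perturbation_norm_attained:
  fixes A :: "real^'n^'m"
  obtains C d where "C *v y = d"
    and "(norm (residual A b y))\<^sup>2 = (1 + y \<bullet> y) * (norm (augmented A b - augmented C d))\<^sup>2"
proof
  define s where "s = 1 + y \<bullet> y"
  define \<rho> where "\<rho> = residual A b y"
  have s: "s > 0" by (simp add: s_def add_pos_nonneg)
  define C where "C = A + (1 / s) *\<^sub>R outer \<rho> y"
  have eq: "C *v y = b - (1 / s) *\<^sub>R \<rho>"
  proof -
    have "C *v y = A *v y + ((y \<bullet> y) / s) *\<^sub>R \<rho>"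
      by (simp add: C_def matrix_vector_mult_add_rdistrib scaleR_matrix_vector_assoc[symmetric]
          outer_mult_vec)
    also have "(y \<bullet> y) / s = 1 - 1 / s"
      using s by (simp add: s_def field_simps)
    finally show ?thesis by (simp add: \<rho>_def residual_def algebra_simps)
  qed
  show "C *v y = C *v y" ..
  have "(norm (augmented A b - augmented C (C *v y)))\<^sup>2
      = (\<Sum>i\<in>UNIV. (norm (- (1 / s) *\<^sub>R \<rho> $ i *\<^sub>R y, (1 / s) * \<rho> $ i))\<^sup>2)"
    unfolding augmented_diff norm_augmented_sq eq
    by (simp add: C_def outer_nth)
  also have "\<dots> = (\<Sum>i\<in>UNIV. (\<rho> $ i)\<^sup>2 / s)"
  proof (rule sum.cong[OF refl])
    fix i
    have "(norm (- (1 / s) *\<^sub>R \<rho> $ i *\<^sub>R y, (1 / s) * \<rho> $ i))\<^sup>2 = (\<rho> $ i)\<^sup>2 / s\<^sup>2 * s"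
      unfolding power2_norm_eq_inner by (simp add: s_def power2_eq_square algebra_simps add_divide_distrib)
    then show "(norm (- (1 / s) *\<^sub>R \<rho> $ i *\<^sub>R y, (1 / s) * \<rho> $ i))\<^sup>2 = (\<rho> $ i)\<^sup>2 / s"
      using s by (simp add: power2_eq_square)
  qed
  also have "\<dots> = (norm \<rho>)\<^sup>2 / s"
    unfolding power2_norm_eq_inner
    by (simp add: inner_vec_def power2_eq_square sum_divide_distrib)
  finally show "(norm (residual A b y))\<^sup>2
      = (1 + y \<bullet> y) * (norm (augmented A b - augmented C (C *v y)))\<^sup>2"
    using s by (simp add: \<rho>_def s_def[symmetric])
qed

text \<open>
  Minimality of the quotient \<open>\<parallel>b - A y\<parallel>\<^sup>2 / (1 + y\<^sup>T y)\<close> at \<open>x\<close>, with denominators cleared. The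
  minimizer witnessing that \<open>x\<close> is a solution costs at least the quotient at \<open>x\<close>, and at most what
  the optimal perturbation for \<open>y\<close> costs.
\<close>

lemma tls_solution_minimizes_quotient:
  assumes "tls_solution A b x"
  shows "(norm (residual A b x))\<^sup>2 * (1 + y \<bullet> y) \<le> (norm (residual A b y))\<^sup>2 * (1 + x \<bullet> x)"
proof -
  from assms obtain A' where
    min: "is_arg_min (\<lambda>(C, d). norm (augmented A b - augmented C d))
            (\<lambda>(C, d). d \<in> range (\<lambda>y. C *v y)) (A', A' *v x)"
    unfolding tls_solution_def by blast
  obtain C d where C: "C *v y = d"
    "(norm (residual A b y))\<^sup>2 = (1 + y \<bullet> y) * (norm (augmented A b - augmented C d))\<^sup>2"
    by (rule perturbation_norm_attained)
  have "norm (augmented A b - augmented A' (A' *v x)) \<le> norm (augmented A b - augmented C d)"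
    using min C(1) unfolding is_arg_min_linorder by auto
  then have le: "(norm (augmented A b - augmented A' (A' *v x)))\<^sup>2
      \<le> (norm (augmented A b - augmented C d))\<^sup>2"
    by (simp add: power_mono)
  have "(norm (residual A b x))\<^sup>2 \<le> (1 + x \<bullet> x) * (norm (augmented A b - augmented A' (A' *v x)))\<^sup>2"
    by (rule perturbation_norm_lower_bound) simp
  also have "\<dots> \<le> (1 + x \<bullet> x) * (norm (augmented A b - augmented C d))\<^sup>2"
    using le by (intro mult_left_mono) (auto intro: add_nonneg_nonneg)
  finally have "(norm (residual A b x))\<^sup>2 * (1 + y \<bullet> y)
      \<le> (1 + x \<bullet> x) * (norm (augmented A b - augmented C d))\<^sup>2 * (1 + y \<bullet> y)"
    by (intro mult_right_mono) (auto intro: add_nonneg_nonneg)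
  then show ?thesis unfolding C(2) by (simp add: mult_ac)
qed

text \<open>
  First-order optimality at \<open>t = 0\<close> for a quadratic polynomial that is nonnegative everywhere: if
  \<open>c\<close> were nonzero, a small step in the direction \<open>- c\<close> would make the value negative.
\<close>

lemma linear_coeff_zero_if_quadratic_nonneg:
  fixes c d :: real
  assumes "\<And>t. 0 \<le> c * t + d * t\<^sup>2"
  shows "c = 0"
proof (rule ccontr)
  assume c: "c \<noteq> 0"
  define s where "s = 1 / (\<bar>d\<bar> + 1)"
  have s: "s > 0" and ds: "d * s < 1"
    by (auto simp: s_def divide_less_eq)
  \<comment> \<open>At \<open>t = - s c\<close> the step is short enough for the linear term to dominate.\<close>
  have "0 \<le> s * c\<^sup>2 * (d * s - 1)"
    using assms[of "- s * c"] by (simp add: power2_eq_square algebra_simps)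
  moreover have "s * c\<^sup>2 * (d * s - 1) < 0"
    using s ds c by (intro mult_pos_neg) auto
  ultimately show False by simp
qed

text \<open>
  Let \<open>g\<close> be the difference of the two sides. Moving from \<open>x\<close> in direction \<open>g\<close> by \<open>t\<close>, the minimality
  inequality of the quotient becomes a quadratic polynomial in \<open>t\<close> that is nonnegative and has
  linear coefficient \<open>-2 g\<^sup>T g\<close>, so \<open>g = 0\<close>.
\<close>

lemma tls_stationarity:
  fixes A :: "real^'n^'m"
  assumes "tls_solution A b x"
  shows "(1 + x \<bullet> x) *\<^sub>R (transpose A *v residual A b x)
    = - (norm (residual A b x))\<^sup>2 *\<^sub>R x"
proof -
  define r where "r = residual A b x"
  define s where "s = 1 + x \<bullet> x"
  define g where "g = s *\<^sub>R (transpose A *v r) + (norm r)\<^sup>2 *\<^sub>R x"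
  have "- 2 * (g \<bullet> g) = 0"
  proof (rule linear_coeff_zero_if_quadratic_nonneg)
    fix t :: real
    define u where "u = A *v g"
    have "residual A b (x + t *\<^sub>R g) = r - t *\<^sub>R u"
      by (simp add: residual_def r_def u_def matrix_vector_right_distrib
          matrix_vector_mult_scaleR)
    then have "(norm r)\<^sup>2 * (1 + (x + t *\<^sub>R g) \<bullet> (x + t *\<^sub>R g)) \<le> (norm (r - t *\<^sub>R u))\<^sup>2 * s"
      using tls_solution_minimizes_quotient[OF assms, of "x + t *\<^sub>R g"]
      by (simp only: r_def s_def)
    also have "(norm (r - t *\<^sub>R u))\<^sup>2 = (norm r)\<^sup>2 - 2 * t * (r \<bullet> u) + t\<^sup>2 * (u \<bullet> u)"
      unfolding power2_norm_eq_inner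
      by (simp add: inner_diff inner_commute power2_eq_square algebra_simps)
    also have "1 + (x + t *\<^sub>R g) \<bullet> (x + t *\<^sub>R g) = s + 2 * t * (x \<bullet> g) + t\<^sup>2 * (g \<bullet> g)"
      by (simp add: s_def inner_add inner_commute power2_eq_square algebra_simps)
    finally have "0 \<le> ((norm r)\<^sup>2 - 2 * t * (r \<bullet> u) + t\<^sup>2 * (u \<bullet> u)) * s
        - (norm r)\<^sup>2 * (s + 2 * t * (x \<bullet> g) + t\<^sup>2 * (g \<bullet> g))"
      by simp
    also have "\<dots> = - 2 * (s * (r \<bullet> u) + (norm r)\<^sup>2 * (x \<bullet> g)) * t
        + (s * (u \<bullet> u) - (norm r)\<^sup>2 * (g \<bullet> g)) * t\<^sup>2"
      by algebra
    also have "s * (r \<bullet> u) + (norm r)\<^sup>2 * (x \<bullet> g) = g \<bullet> g"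
      by (subst (3) g_def) (simp add: inner_add_right inner_commute[of g] u_def
          dot_lmul_matrix[symmetric])
    finally show "0 \<le> - 2 * (g \<bullet> g) * t + (s * (u \<bullet> u) - (norm r)\<^sup>2 * (g \<bullet> g)) * t\<^sup>2" .
  qed
  then have "g = 0" by simp
  then show ?thesis by (simp add: g_def r_def s_def add_eq_0_iff)
qed

section \<open>The two condition number matrices coincide\<close>

lemma G_mat_eq_hcat:
  "G_mat x = hcat (\<chi> i j. if i = snd j then x $ fst j else 0) (- mat 1 :: real^'m^'m)"
  by (auto simp: G_mat_def reindex_def kron_def hcat_def rowvector_def mat_def vec_eq_iff
      split: sum.split)

text \<open>
  The block diagonal matrix \<open>M\<^sup>s\<^sup>t\<^sub>A\<^sub>b\<close> acts on each block of columns separately, which leaves only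
  products with \<open>Mst S\<close> to compute. Column \<open>q\<close> of that matrix is \<open>vec S\<^sub>q\<close>.
\<close>

lemma hcat_mult_Mst_Ab:
  fixes B :: "real^('n::finite \<times> 'm::finite)^'k"
  shows "hcat B D ** Mst_Ab S = hcat (B ** Mst S) D"
  by (simp add: Mst_Ab_def hcat_mult_vcat mult_hcat hcat_add)

lemma G_mat_mult_Mst_Ab:
  fixes S :: "'q::finite \<Rightarrow> real^'n^'m"
  shows "G_mat x ** Mst_Ab S = hcat (\<chi> i q. (S q *v x) $ i) (- mat 1)"
proof -
  have "(\<Sum>k\<in>UNIV. (if i = snd k then x $ fst k else 0) * S q $ snd k $ fst k)
      = (\<Sum>j\<in>UNIV. S q $ i $ j * x $ j)" for i q
    unfolding UNIV_Times_UNIV[symmetric] sum.cartesian_product'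
    by (simp add: if_distrib[of "\<lambda>z. z * _"] mult.commute[of "S _ $ _ $ _"] cong: if_cong)
  then have "(\<chi> i k. if i = snd k then x $ fst k else 0) ** Mst S = (\<chi> i q. (S q *v x) $ i)"
    by (simp add: matrix_matrix_mult_def matrix_vector_mult_def Mst_def vec_of_mat_def)
  then show ?thesis
    by (simp only: G_mat_eq_hcat hcat_mult_Mst_Ab)
qed

lemma I_kron_row_mult_Mst:
  fixes S :: "'q::finite \<Rightarrow> real^'n^'m"
  shows "I_kron_row r ** Mst S = (\<chi> j q. (transpose (S q) *v r) $ j)"
proof -
  have "(\<Sum>k\<in>UNIV. (if j = fst k then 1 else 0) * r $ snd k * S q $ snd k $ fst k)
      = (\<Sum>i\<in>UNIV. S q $ i $ j * r $ i)" for j q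
    unfolding UNIV_Times_UNIV[symmetric] sum.cartesian_product'
    by (subst sum.swap)
      (simp add: if_distrib[of "\<lambda>z. z * _"] mult.commute[of "S _ $ _ $ _"] cong: if_cong)
  then show ?thesis
    by (simp add: I_kron_row_def reindex_def kron_def mat_def rowvector_def
        matrix_matrix_mult_def matrix_vector_mult_def Mst_def vec_of_mat_def transpose_def vec_eq_iff)
qed

text \<open>
  Stationarity turns \<open>2 A\<^sup>T r r\<^sup>T / \<parallel>r\<parallel>\<^sup>2 - A\<^sup>T\<close>, the factor of \<open>G(x)\<close> in \<open>K\<close>, into \<open>- Q\<close>.
\<close>

lemma K_mat_eq:
  assumes "tls_solution A b x" and "residual A b x \<noteq> 0"
  shows "K_mat A b x = matrix_inv (P_mat A b) **
    (hcat (I_kron_row (residual A b x)) 0 - Q_mat A b x ** G_mat x)"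
proof -
  define r where "r = residual A b x"
  have s: "1 + x \<bullet> x > 0" by (simp add: add_pos_nonneg)
  have "transpose A *v r = (- ((norm r)\<^sup>2 / (1 + x \<bullet> x))) *\<^sub>R x"
    using arg_cong[OF tls_stationarity[OF assms(1)], of "\<lambda>z. (1 / (1 + x \<bullet> x)) *\<^sub>R z"] s
    by (simp add: r_def)
  then have "transpose A ** ((1 / (norm r)\<^sup>2) *\<^sub>R outer r r) = - (1 / (1 + x \<bullet> x)) *\<^sub>R outer x r"
    using assms(2)
    by (simp add: matrix_scalar_ac mult_outer outer_scaleR_left outer_minus_left r_def
        scaleR_matrix_vector_assoc[symmetric] del: transpose_matrix_vector)
  then show ?thesis
    unfolding K_mat_def Let_def Q_mat_def r_def[symmetric]
    by (simp add: matrix_add_mult_rdistrib matrix_minus_mult scalar_matrix_assoc[symmetric]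
        algebra_simps)
qed

text \<open>
  The second block is \<open>H\<close> without a sign because the factors \<open>- Q\<close> of \<open>K\<close> and \<open>- I\<close> of \<open>G(x)\<close> both
  change it. In the first block, column \<open>q\<close> is \<open>S\<^sub>q\<^sup>T r - Q S\<^sub>q x\<close>, which is \<open>v\<^sub>q\<close>.
\<close>

lemma K_mat_mult_Mst_Ab:
  assumes "tls_solution A b x" and "residual A b x \<noteq> 0"
  shows "K_mat A b x ** Mst_Ab S = hcat (N_mat S A b x) (H_mat A b x)"
proof -
  define r where "r = residual A b x"
  define Q where "Q = Q_mat A b x"
  have V: "V_mat S A b x = (\<chi> j q. (transpose (S q) *v r) $ j) - Q ** (\<chi> i q. (S q *v x) $ i)"
    by (simp add: V_mat_def r_def Q_def vec_eq_iff matrix_matrix_mult_def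
        matrix_vector_mult_def)
  have "(hcat (I_kron_row r) 0 - Q ** G_mat x) ** Mst_Ab S
      = hcat (I_kron_row r) 0 ** Mst_Ab S - Q ** (G_mat x ** Mst_Ab S)"
    by (simp add: matrix_diff_rdistrib matrix_mul_assoc)
  also have "\<dots> = hcat (V_mat S A b x) Q"
    by (simp add: hcat_mult_Mst_Ab I_kron_row_mult_Mst G_mat_mult_Mst_Ab mult_hcat hcat_diff
        matrix_mult_minus V)
  finally show ?thesis
    unfolding K_mat_eq[OF assms] N_mat_def H_mat_def r_def Q_def
    by (simp add: matrix_mul_assoc[symmetric] mult_hcat)
qed

theorem theorem3p4:
  fixes \<S> :: "(real^'n^'m) set"
    and S :: "'q::finite \<Rightarrow> real^'n^'m"
    and a :: "real^'q"
    and A :: "real^'n^'m"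
    and b :: "real^'m"
    and x :: "real^'n"
  assumes "CARD('m) > CARD('n)"
    and "subspace \<S>"
    and "inj S" and "independent (range S)" and "span (range S) = \<S>"
    and "A \<in> \<S>" and "A = (\<Sum>i\<in>UNIV. a $ i *\<^sub>R S i)"
    and "smallest_singular_value A > smallest_singular_value (augmented A b)"
    and "tls_solution A b x"
    and "x \<noteq> 0" and "residual A b x \<noteq> 0"
  shows "kappa_s_inf_rel (mat 1 :: real^'n^'n) S a A b x = m_s S a A b x"
  using K_mat_mult_Mst_Ab[OF assms(9,11), of S]
  by (simp add: kappa_s_inf_rel_def m_s_def abs_hcat hcat_vector_mult_vcat)

end
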